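(* Let $\mathbb{P}$ be a probability measure on a measurable space $(\Omega,\mathcal{F})$, let $\mathcal{H}=\mathcal{L}^1(\Omega,\mathcal{F},\mathbb{P})$ with the $L^1(\mathbb{P})$-norm topology $\tau$, and let the pre-order on $\mathcal{H}$ be given by $X\le Y$ if and only if $\mathbb{E}_{\mathbb{P}}[X]\le\mathbb{E}_{\mathbb{P}}[Y]$. Let $\mathcal{R}=\mathcal{P}^+$ be the set of all positive claims, i.e. $\mathcal{R}=\{X\in\mathcal{H}:\mathbb{E}_{\mathbb{P}}[X]>0\}$, and let $\mathcal{I}\subset\mathcal{H}$ be the linear subspace of net trades of a frictionless finite-horizon discrete-time financial market (see context). Then the financial market $(\mathcal{H},\tau,\le,\mathcal{I},\mathcal{R})$ is viable if and only if $\mathbb{P}$ is a martingale measure. In this case, $\mathbb{P}$ is the unique martingale measure.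
   Context: Net trades: there are a filtration $(\mathcal{F}_t)_{t=0}^T$ on $(\Omega,\mathcal{F})$ ($T\ge1$), an adapted $\mathbb{R}^J_+$-valued process $S=(S_t)_{t=0}^T$ (discounted prices, with a riskless bond with interest rate zero), and $\mathcal{I}$ is the set of $\ell\in\mathcal{H}$ of the form $\ell=\sum_{t=1}^T H_t\cdot(S_t-S_{t-1})$ with $H_t$ an $\mathcal{F}_{t-1}$-measurable $\mathbb{R}^J$-valued function; $\mathcal{I}$ is a linear subspace of $\mathcal{H}$. Agents: $\mathcal{A}$ is the set of complete and transitive binary relations $\preceq$ on $\mathcal{H}$ (with strict part $\prec$) that are (i) weakly monotone: $X\le Y$ implies $X\preceq Y$; (ii) convex: $\{Z\in\mathcal{H}: X\preceq Z\}$ is convex for every $X$; (iii) $\tau$-lower semi-continuous: if $X_n\to X$ in $\tau$ and $X_n\preceq Y$ for all $n$, then $X\preceq Y$. Viability: the market is viable if there is a family $\{\preceq_a\}_{a\in A}\subset\mathcal{A}$ such that $\ell\preceq_a 0$ for every $a\in A$ and $\ell\in\mathcal{I}$, and for every $R\in\mathcal{R}$ there is $a\in A$ with $0\prec_a R$. Martingale measure: a probability measure $\mathbb{Q}$ on $(\Omega,\mathcal{F})$ such that $X\mapsto\mathbb{E}_{\mathbb{Q}}[X]$ is a well-defined $\tau$-continuous linear functional on $\mathcal{H}$ which is positive with respect to $\le$ ($X\ge0$ implies $\mathbb{E}_{\mathbb{Q}}[X]\ge0$), vanishes on negligible claims (those $Z$ with $0\le Z$ and $Z\le0$, i.e. $\mathbb{E}_{\mathbb{P}}[Z]=0$),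 and satisfies $\mathbb{E}_{\mathbb{Q}}[\ell]\le0$ for all $\ell\in\mathcal{I}$ (equivalently $=0$, since $\mathcal{I}$ is a linear space). *)

theory Defs
  imports "HOL-Probability.Probability"
begin

section \<open>Financial markets over a space of real-valued claims\<close>

text \<open>
  Claims are functions \<^typ>\<open>'a \<Rightarrow> real\<close> and \<open>H\<close> is the set of admissible claims. A binary
  relation on \<open>H\<close> is a subset of \<open>H \<times> H\<close>, where \<open>(X, Y) \<in> r\<close> means that \<open>X\<close> is weakly below \<open>Y\<close>.
\<close>

definition strictly_below :: "'h rel \<Rightarrow> 'h \<Rightarrow> 'h \<Rightarrow> bool" where
  "strictly_below r X Y \<longleftrightarrow> (X, Y) \<in> r \<and> (Y, X) \<notin> r"

definition convex_claims :: "('a \<Rightarrow> real) set \<Rightarrow> bool" where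
  "convex_claims C \<longleftrightarrow>
     (\<forall>X\<in>C. \<forall>Y\<in>C. \<forall>u\<in>{0..1::real}. (\<lambda>\<omega>. u * X \<omega> + (1 - u) * Y \<omega>) \<in> C)"

definition agents ::
  "('a \<Rightarrow> real) set \<Rightarrow> ('a \<Rightarrow> real) topology \<Rightarrow> ('a \<Rightarrow> real) rel \<Rightarrow> ('a \<Rightarrow> real) rel set" where
  "agents H \<tau> le = {r. r \<subseteq> H \<times> H
     \<and> (\<forall>X\<in>H. \<forall>Y\<in>H. (X, Y) \<in> r \<or> (Y, X) \<in> r)
     \<and> trans r
     \<and> (\<forall>X\<in>H. \<forall>Y\<in>H. (X, Y) \<in> le \<longrightarrow> (X, Y) \<in> r)
     \<and> (\<forall>X\<in>H. convex_claims {Z \<in> H. (X, Z) \<in> r})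
     \<and> (\<forall>Xs. \<forall>X\<in>H. \<forall>Y\<in>H. (\<forall>n::nat. Xs n \<in> H) \<longrightarrow> limitin \<tau> Xs X sequentially \<longrightarrow>
          (\<forall>n. (Xs n, Y) \<in> r) \<longrightarrow> (X, Y) \<in> r)}"

text \<open>A family of preferences enters viability only through its range, so it is given as a set.\<close>

definition viable ::
  "('a \<Rightarrow> real) set \<Rightarrow> ('a \<Rightarrow> real) topology \<Rightarrow> ('a \<Rightarrow> real) rel \<Rightarrow>
   ('a \<Rightarrow> real) set \<Rightarrow> ('a \<Rightarrow> real) set \<Rightarrow> bool" where
  "viable H \<tau> le I R \<longleftrightarrow> (\<exists>A \<subseteq> agents H \<tau> le.
     (\<forall>r\<in>A. \<forall>l\<in>I. (l, \<lambda>_. 0) \<in> r) \<and>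
     (\<forall>X\<in>R. \<exists>r\<in>A. strictly_below r (\<lambda>_. 0) X))"

definition linear_functional_on :: "('a \<Rightarrow> real) set \<Rightarrow> (('a \<Rightarrow> real) \<Rightarrow> real) \<Rightarrow> bool" where
  "linear_functional_on H \<phi> \<longleftrightarrow>
     (\<forall>X\<in>H. \<forall>Y\<in>H. \<forall>a b. \<phi> (\<lambda>\<omega>. a * X \<omega> + b * Y \<omega>) = a * \<phi> X + b * \<phi> Y)"

definition negligible_claims :: "('a \<Rightarrow> real) set \<Rightarrow> ('a \<Rightarrow> real) rel \<Rightarrow> ('a \<Rightarrow> real) set" where
  "negligible_claims H le = {Z \<in> H. (\<lambda>_. 0, Z) \<in> le \<and> (Z, \<lambda>_. 0) \<in> le}"

text \<open>
  \<open>M\<close> only contributes its measurable space. Integrability of all claims is what makes the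
  functional well-defined: \<^const>\<open>lebesgue_integral\<close> is \<open>0\<close> on non-integrable functions.
\<close>

definition martingale_measure ::
  "'a measure \<Rightarrow> ('a \<Rightarrow> real) set \<Rightarrow> ('a \<Rightarrow> real) topology \<Rightarrow> ('a \<Rightarrow> real) rel \<Rightarrow>
   ('a \<Rightarrow> real) set \<Rightarrow> 'a measure \<Rightarrow> bool" where
  "martingale_measure M H \<tau> le I Q \<longleftrightarrow>
     prob_space Q \<and> sets Q = sets M
     \<and> (\<forall>X\<in>H. integrable Q X)
     \<and> linear_functional_on H (\<lambda>X. LINT \<omega>|Q. X \<omega>)
     \<and> continuous_map \<tau> euclideanreal (\<lambda>X. LINT \<omega>|Q. X \<omega>)
     \<and> (\<forall>X\<in>H. (\<lambda>_. 0, X) \<in> le \<longrightarrow> 0 \<le> (LINT \<omega>|Q. X \<omega>))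
     \<and> (\<forall>Z\<in>negligible_claims H le. (LINT \<omega>|Q. Z \<omega>) = 0)
     \<and> (\<forall>l\<in>I. (LINT \<omega>|Q. l \<omega>) \<le> 0)"


section \<open>The market of integrable claims ordered by expectation\<close>

definition L1_claims :: "'a measure \<Rightarrow> ('a \<Rightarrow> real) set" where
  "L1_claims P = {X. integrable P X}"

text \<open>
  The topology of the \<open>L\<^sup>1\<close> seminorm. Claims are functions, not classes modulo almost-everywhere
  equality, so this is not Hausdorff.
\<close>

definition L1_topology :: "'a measure \<Rightarrow> ('a \<Rightarrow> real) topology" where
  "L1_topology P = topology (\<lambda>U. U \<subseteq> L1_claims P \<and>
     (\<forall>X\<in>U. \<exists>e>0. \<forall>Y\<in>L1_claims P. (LINT \<omega>|P. \<bar>Y \<omega> - X \<omega>\<bar>) < e \<longrightarrow> Y \<in> U))"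

definition expectation_order :: "'a measure \<Rightarrow> ('a \<Rightarrow> real) rel" where
  "expectation_order P = {(X, Y). X \<in> L1_claims P \<and> Y \<in> L1_claims P \<and>
     (LINT \<omega>|P. X \<omega>) \<le> (LINT \<omega>|P. Y \<omega>)}"

definition positive_claims :: "'a measure \<Rightarrow> ('a \<Rightarrow> real) set" where
  "positive_claims P = {X \<in> L1_claims P. 0 < (LINT \<omega>|P. X \<omega>)}"

text \<open>
  The riskless bond is constantly \<open>1\<close> in discounted terms, has zero increments, and hence does not
  occur in the sum.
\<close>

definition net_trades ::
  "'a measure \<Rightarrow> (nat \<Rightarrow> 'a measure) \<Rightarrow> nat \<Rightarrow> (nat \<Rightarrow> 'a \<Rightarrow> real ^ 'j) \<Rightarrow> ('a \<Rightarrow> real) set" where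
  "net_trades P F T S = {l \<in> L1_claims P. \<exists>h :: nat \<Rightarrow> 'a \<Rightarrow> real ^ 'j.
     (\<forall>t\<in>{1..T}. h t \<in> borel_measurable (F (t - 1))) \<and>
     (\<forall>\<omega>\<in>space P. l \<omega> = (\<Sum>t=1..T. h t \<omega> \<bullet> (S t \<omega> - S (t - 1) \<omega>)))}"


lemma positive_claims_iff_strictly_below:
  "X \<in> positive_claims P \<longleftrightarrow> strictly_below (expectation_order P) (\<lambda>_. 0) X"
  by (auto simp: positive_claims_def strictly_below_def expectation_order_def L1_claims_def)

lemma openin_L1_topology:
  "openin (L1_topology P) U \<longleftrightarrow> U \<subseteq> L1_claims P \<and>
     (\<forall>X\<in>U. \<exists>e>0. \<forall>Y\<in>L1_claims P. (LINT \<omega>|P. \<bar>Y \<omega> - X \<omega>\<bar>) < e \<longrightarrow> Y \<in> U)"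
proof -
  let ?O = "\<lambda>U. U \<subseteq> L1_claims P \<and>
     (\<forall>X\<in>U. \<exists>e>0. \<forall>Y\<in>L1_claims P. (LINT \<omega>|P. \<bar>Y \<omega> - X \<omega>\<bar>) < e \<longrightarrow> Y \<in> U)"
  have int: "?O (U \<inter> V)" if U: "?O U" and V: "?O V" for U V
  proof (intro conjI ballI)
    show "U \<inter> V \<subseteq> L1_claims P" using U by blast
    fix X assume "X \<in> U \<inter> V"
    then obtain d e where
      "d > 0" "\<forall>Y\<in>L1_claims P. (LINT \<omega>|P. \<bar>Y \<omega> - X \<omega>\<bar>) < d \<longrightarrow> Y \<in> U"
      "e > 0" "\<forall>Y\<in>L1_claims P. (LINT \<omega>|P. \<bar>Y \<omega> - X \<omega>\<bar>) < e \<longrightarrow> Y \<in> V"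
      using U V by blast
    then show "\<exists>e>0. \<forall>Y\<in>L1_claims P. (LINT \<omega>|P. \<bar>Y \<omega> - X \<omega>\<bar>) < e \<longrightarrow> Y \<in> U \<inter> V"
      by (intro exI[of _ "min d e"]) auto
  qed
  have Un: "?O (\<Union>K)" if K: "\<forall>U\<in>K. ?O U" for K
  proof (intro conjI ballI)
    show "\<Union>K \<subseteq> L1_claims P" using K by blast
    fix X assume "X \<in> \<Union>K"
    then obtain U where U: "U \<in> K" "X \<in> U" by blast
    then obtain e where "e > 0" "\<forall>Y\<in>L1_claims P. (LINT \<omega>|P. \<bar>Y \<omega> - X \<omega>\<bar>) < e \<longrightarrow> Y \<in> U"
      using K by blast
    with U show "\<exists>e>0. \<forall>Y\<in>L1_claims P. (LINT \<omega>|P. \<bar>Y \<omega> - X \<omega>\<bar>) < e \<longrightarrow> Y \<in> \<Union>K"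
      by blast
  qed
  have "istopology ?O"
    unfolding istopology_def using int Un by blast
  then show ?thesis
    unfolding L1_topology_def by (simp add: topology_inverse')
qed

lemma topspace_L1_topology: "topspace (L1_topology P) = L1_claims P"
proof
  show "topspace (L1_topology P) \<subseteq> L1_claims P"
    by (auto simp: topspace_def openin_L1_topology)
  have "openin (L1_topology P) (L1_claims P)"
    by (auto simp: openin_L1_topology intro: exI[of _ 1])
  then show "L1_claims P \<subseteq> topspace (L1_topology P)"
    by (rule openin_subset)
qed

end

theory Submission
  imports Defs
begin

text \<open>
  The expectation preference is itself an agent, so it witnesses viability as soon as no net trade
  has positive expectation. Conversely a net trade of positive expectation is relevant, and no
  agent can both strictly prefer it to \<open>0\<close> and find it no better than \<open>0\<close>. Uniqueness holds because
  \<open>1\<^sub>B - P(B)\<close> is negligible for every event \<open>B\<close>, which forces \<open>Q(B) = P(B)\<close>.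
\<close>

text \<open>Expectation is 1-Lipschitz for the \<open>L1\<close> seminorm, so a radius
  \<open>e\<close> that works around the value of the integral in \<open>U\<close> also works around
  the claim \<open>X\<close>.\<close>

lemma continuous_map_L1_integral:
  "continuous_map (L1_topology P) euclideanreal (\<lambda>X. LINT \<omega>|P. X \<omega>)"
proof (rule continuous_map[THEN iffD2], intro conjI allI impI)
  fix U :: "real set"
  assume "openin euclideanreal U"
  then have U: "open U" by simp
  show "openin (L1_topology P) {X \<in> topspace (L1_topology P). (LINT \<omega>|P. X \<omega>) \<in> U}"
    unfolding openin_L1_topology topspace_L1_topology
  proof (intro conjI ballI)
    fix X assume X: "X \<in> {X \<in> L1_claims P. (LINT \<omega>|P. X \<omega>) \<in> U}"
    then obtain e where e: "e > 0" "\<And>y. dist y (LINT \<omega>|P. X \<omega>) < e \<Longrightarrow> y \<in> U"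
      using U unfolding open_dist by blast
    have "Y \<in> {X \<in> L1_claims P. (LINT \<omega>|P. X \<omega>) \<in> U}"
      if Y: "Y \<in> L1_claims P" "(LINT \<omega>|P. \<bar>Y \<omega> - X \<omega>\<bar>) < e" for Y
    proof -
      have "\<bar>LINT \<omega>|P. Y \<omega> - X \<omega>\<bar> \<le> (LINT \<omega>|P. \<bar>Y \<omega> - X \<omega>\<bar>)"
        by (rule integral_abs_bound)
      moreover have "(LINT \<omega>|P. Y \<omega> - X \<omega>) = (LINT \<omega>|P. Y \<omega>) - (LINT \<omega>|P. X \<omega>)"
        using X Y by (intro Bochner_Integration.integral_diff) (auto simp: L1_claims_def)
      ultimately show ?thesis
        using e(2) Y by (simp add: dist_real_def)
    qed
    then show "\<exists>e>0. \<forall>Y\<in>L1_claims P. (LINT \<omega>|P. \<bar>Y \<omega> - X \<omega>\<bar>) < e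
        \<longrightarrow> Y \<in> {X \<in> L1_claims P. (LINT \<omega>|P. X \<omega>) \<in> U}"
      using e(1) by blast
  qed auto
qed auto

lemma integral_L1_combination:
  assumes "X \<in> L1_claims P" "Y \<in> L1_claims P"
  shows "(\<lambda>\<omega>. a * X \<omega> + b * Y \<omega>) \<in> L1_claims P"
    and "(LINT \<omega>|P. a * X \<omega> + b * Y \<omega>) = a * (LINT \<omega>|P. X \<omega>) + b * (LINT \<omega>|P. Y \<omega>)"
  using assms by (auto simp: L1_claims_def)

text \<open>Upper sets of this preference are half-spaces of the linear functional expectation,
  hence convex; lower semi-continuity is the continuity of that functional.\<close>

lemma expectation_order_in_agents:
  "expectation_order P \<in> agents (L1_claims P) (L1_topology P) (expectation_order P)"
proof -
  have "convex_claims {Z \<in> L1_claims P. (X, Z) \<in> expectation_order P}"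
    if X: "X \<in> L1_claims P" for X
    unfolding convex_claims_def
  proof (intro ballI)
    fix Y Z and u :: real
    assume Y: "Y \<in> {Z \<in> L1_claims P. (X, Z) \<in> expectation_order P}"
      and Z: "Z \<in> {Z \<in> L1_claims P. (X, Z) \<in> expectation_order P}"
      and u: "u \<in> {0..1}"
    \<comment> \<open>The expectation of \<open>X\<close> is split with the weights \<open>u\<close>
      and \<open>1 - u\<close>, so that the bound holds summand by summand.\<close>
    have "u * (LINT \<omega>|P. X \<omega>) + (1 - u) * (LINT \<omega>|P. X \<omega>)
        \<le> u * (LINT \<omega>|P. Y \<omega>) + (1 - u) * (LINT \<omega>|P. Z \<omega>)"
      using Y Z u by (intro add_mono mult_left_mono) (auto simp: expectation_order_def)
    then show "(\<lambda>\<omega>. u * Y \<omega> + (1 - u) * Z \<omega>)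
        \<in> {Z \<in> L1_claims P. (X, Z) \<in> expectation_order P}"
      using X Y Z integral_L1_combination[of Y P Z u "1 - u"]
      by (simp add: expectation_order_def algebra_simps)
  qed
  moreover have "(X, Y) \<in> expectation_order P"
    if "X \<in> L1_claims P" "Y \<in> L1_claims P" "limitin (L1_topology P) Xs X sequentially"
      and le: "\<forall>n. (Xs n, Y) \<in> expectation_order P" for Xs X Y
  proof -
    have "(\<lambda>n. LINT \<omega>|P. Xs n \<omega>) \<longlonglongrightarrow> (LINT \<omega>|P. X \<omega>)"
      using continuous_map_limit[OF continuous_map_L1_integral that(3)] by (simp add: o_def)
    then have "(LINT \<omega>|P. X \<omega>) \<le> (LINT \<omega>|P. Y \<omega>)"
      using le by (intro LIMSEQ_le_const2) (auto simp: expectation_order_def)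
    with that show ?thesis by (simp add: expectation_order_def)
  qed
  moreover have "trans (expectation_order P)"
    unfolding trans_def expectation_order_def by auto
  ultimately show ?thesis
    unfolding agents_def by (auto simp: expectation_order_def)
qed

text \<open>For \<open>P\<close> itself positivity is the definition of the order, and negligible
  claims are those of expectation zero. Only the condition on net trades remains, which is also what
  viability reduces to.\<close>

lemma martingale_measure_expectation_iff:
  assumes "prob_space P"
  shows "martingale_measure P (L1_claims P) (L1_topology P) (expectation_order P) I P
    \<longleftrightarrow> (\<forall>l\<in>I. (LINT \<omega>|P. l \<omega>) \<le> 0)"
  using assms continuous_map_L1_integral[of P]
  by (auto simp: martingale_measure_def linear_functional_on_def integral_L1_combination
      negligible_claims_def expectation_order_def L1_claims_def)

lemma viable_expectation_iff:
  assumes "I \<subseteq> L1_claims P"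
  shows "viable (L1_claims P) (L1_topology P) (expectation_order P) I (positive_claims P)
    \<longleftrightarrow> (\<forall>l\<in>I. (LINT \<omega>|P. l \<omega>) \<le> 0)" (is "?viable \<longleftrightarrow> ?nonpos")
proof
  assume ?viable
  show ?nonpos
  proof (rule ballI, rule ccontr)
    fix l assume l: "l \<in> I" "\<not> (LINT \<omega>|P. l \<omega>) \<le> 0"
    then have "l \<in> positive_claims P"
      using assms by (auto simp: positive_claims_def)
    \<comment> \<open>Some agent ranks \<open>l\<close> strictly above \<open>0\<close>, yet every
      agent of the family ranks \<open>l\<close> weakly below \<open>0\<close>.\<close>
    with \<open>?viable\<close> l(1) show False
      unfolding viable_def strictly_below_def by blast
  qed
next
  assume ?nonpos
  then have "\<forall>l\<in>I. (l, \<lambda>_. 0) \<in> expectation_order P"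
    using assms by (auto simp: expectation_order_def L1_claims_def)
  then show ?viable
    unfolding viable_def
    using expectation_order_in_agents positive_claims_iff_strictly_below
    \<comment> \<open>A single agent suffices: the claims it strictly prefers to \<open>0\<close>
      are exactly the positive ones.\<close>
    by (intro exI[of _ "{expectation_order P}"]) blast
qed

lemma martingale_measure_expectation_unique:
  assumes "prob_space P"
    and Q: "martingale_measure P (L1_claims P) (L1_topology P) (expectation_order P) I Q"
  shows "Q = P"
proof (rule measure_eqI)
  interpret P: prob_space P by fact
  interpret Q: prob_space Q using Q by (simp add: martingale_measure_def)
  show sets: "sets Q = sets P" using Q by (simp add: martingale_measure_def)
  fix B assume B: "B \<in> sets Q"
  then have BP: "B \<in> sets P" using sets by simp
  \<comment> \<open>Centring the indicator makes its \<open>P\<close>-expectation zero, so it lies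
    both weakly above and weakly below \<open>0\<close>.\<close>
  have "integrable P (\<lambda>\<omega>. indicat_real B \<omega> - measure P B)"
    and "(LINT \<omega>|P. indicat_real B \<omega> - measure P B) = 0"
    using BP by (simp_all add: P.emeasure_eq_measure P.prob_space)
  then have "(\<lambda>\<omega>. indicat_real B \<omega> - measure P B)
      \<in> negligible_claims (L1_claims P) (expectation_order P)"
    by (simp add: negligible_claims_def expectation_order_def L1_claims_def)
  then have "(LINT \<omega>|Q. indicat_real B \<omega> - measure P B) = 0"
    using Q unfolding martingale_measure_def by blast
  \<comment> \<open>As \<open>Q\<close> has total mass 1, the constant integrates to
    \<open>measure P B\<close>.\<close>
  then have "measure Q B = measure P B"
    using B by (simp add: Q.emeasure_eq_measure Q.prob_space)
  then show "emeasure Q B = emeasure P B"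
    by (simp add: P.emeasure_eq_measure Q.emeasure_eq_measure)
qed

theorem proposition3p1:
  fixes P :: "'a measure" and F :: "nat \<Rightarrow> 'a measure" and T :: nat
    and S :: "nat \<Rightarrow> 'a \<Rightarrow> real ^ 'j"
  assumes "prob_space P"
    and "T \<ge> 1"
    and "\<And>t. t \<le> T \<Longrightarrow> subalgebra P (F t)"
    and "\<And>s t. s \<le> t \<Longrightarrow> t \<le> T \<Longrightarrow> sets (F s) \<subseteq> sets (F t)"
    and "\<And>t. t \<le> T \<Longrightarrow> S t \<in> borel_measurable (F t)"
    and "\<And>t \<omega> j. t \<le> T \<Longrightarrow> \<omega> \<in> space P \<Longrightarrow> 0 \<le> S t \<omega> $ j"
  defines "H \<equiv> L1_claims P"
    and "\<tau> \<equiv> L1_topology P"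
    and "le \<equiv> expectation_order P"
    and "I \<equiv> net_trades P F T S"
    and "R \<equiv> positive_claims P"
  shows "(viable H \<tau> le I R \<longleftrightarrow> martingale_measure P H \<tau> le I P) \<and>
         (viable H \<tau> le I R \<longrightarrow> (\<forall>Q. martingale_measure P H \<tau> le I Q \<longleftrightarrow> Q = P))"
proof -
  have "I \<subseteq> L1_claims P"
    unfolding I_def net_trades_def by auto
  then have viable: "viable H \<tau> le I R \<longleftrightarrow> martingale_measure P H \<tau> le I P"
    unfolding H_def \<tau>_def le_def R_def
    by (simp add: viable_expectation_iff martingale_measure_expectation_iff[OF assms(1)])
  \<comment> \<open>This is one direction of the final equivalence; the other, that \<open>P\<close>
    itself qualifies, is what viability supplies.\<close>
  moreover have "Q = P" if "martingale_measure P H \<tau> le I Q" for Q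
    using that unfolding H_def \<tau>_def le_def
    by (rule martingale_measure_expectation_unique[OF assms(1)])
  ultimately show ?thesis by blast
qed

end
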